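(* Let $\gamma \colon [0,1] \to \mathbb{R}^3$ be a simple loop. Then $\gamma$ inscribes sufficiently many parallelograms that their vertex sets are dense in $\gamma([0,1])$; that is, the set of all points that are a vertex of some parallelogram inscribed in $\gamma$ is dense in $\gamma([0,1])$.
   Context: A simple loop in $\mathbb{R}^d$ is a continuous map $\gamma\colon [0,1]\to\mathbb{R}^d$ with $\gamma(0)=\gamma(1)$ that is injective on $[0,1)$ (an embedded continuous closed curve). A loop inscribes a polygon if all vertices of the polygon lie in the image $\gamma([0,1])$. Convention on parallelograms: besides the usual non-degenerate parallelograms, four pairwise distinct points on a line are also considered to be (the vertices of) a parallelogram if they arise as the limit of a sequence of parallelograms. *)

theory Defs
  imports "HOL-Analysis.Analysis"
begin

text \<open>The points \<open>a\<close>, \<open>b\<close>, \<open>c\<close>, \<open>d\<close> are listed in cyclic order, so \<open>{a, c}\<close> and \<open>{b, d}\<close> are the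
  diagonals.\<close>

definition nondegenerate_parallelogram ::
    "'a::real_normed_vector \<Rightarrow> 'a \<Rightarrow> 'a \<Rightarrow> 'a \<Rightarrow> bool" where
  "nondegenerate_parallelogram a b c d \<longleftrightarrow> b - a = c - d \<and> \<not> collinear {a, b, c}"

definition degenerate_parallelogram ::
    "'a::real_normed_vector \<Rightarrow> 'a \<Rightarrow> 'a \<Rightarrow> 'a \<Rightarrow> bool" where
  "degenerate_parallelogram a b c d \<longleftrightarrow>
     distinct [a, b, c, d] \<and> collinear {a, b, c, d} \<and>
     (\<exists>A B C D :: nat \<Rightarrow> 'a.
        (\<forall>n. nondegenerate_parallelogram (A n) (B n) (C n) (D n)) \<and>
        A \<longlonglongrightarrow> a \<and> B \<longlonglongrightarrow> b \<and> C \<longlonglongrightarrow> c \<and> D \<longlonglongrightarrow> d)"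

definition parallelogram :: "'a::real_normed_vector \<Rightarrow> 'a \<Rightarrow> 'a \<Rightarrow> 'a \<Rightarrow> bool" where
  "parallelogram a b c d \<longleftrightarrow>
     nondegenerate_parallelogram a b c d \<or> degenerate_parallelogram a b c d"

definition inscribed_parallelogram_vertices :: "(real \<Rightarrow> 'a::real_normed_vector) \<Rightarrow> 'a set" where
  "inscribed_parallelogram_vertices \<gamma> =
     {p. \<exists>a b c d. parallelogram a b c d \<and> {a, b, c, d} \<subseteq> path_image \<gamma> \<and> p \<in> {a, b, c, d}}"

definition simple_loop :: "(real \<Rightarrow> 'a::topological_space) \<Rightarrow> bool" where
  "simple_loop \<gamma> \<longleftrightarrow> simple_path \<gamma> \<and> pathfinish \<gamma> = pathstart \<gamma>"

lemma simple_loop_iff: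
  "simple_loop \<gamma> \<longleftrightarrow> continuous_on {0..1} \<gamma> \<and> \<gamma> 0 = \<gamma> 1 \<and> inj_on \<gamma> {0..<1}"
proof -
  have "loop_free \<gamma> \<longleftrightarrow> inj_on \<gamma> {0..<1}" if eq: "\<gamma> 0 = \<gamma> 1"
  proof
    assume lf: "loop_free \<gamma>"
    show "inj_on \<gamma> {0..<1}"
    proof (rule inj_onI)
      fix x y :: real
      assume xy: "x \<in> {0..<1}" "y \<in> {0..<1}" "\<gamma> x = \<gamma> y"
      then have "x \<in> {0..1}" "y \<in> {0..1}" by auto
      with lf xy(3) have "x = y \<or> x = 0 \<and> y = 1 \<or> x = 1 \<and> y = 0"
        unfolding loop_free_def by blast
      with xy(1,2) show "x = y" by simp
    qed
  next
    assume inj: "inj_on \<gamma> {0..<1}"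
    show "loop_free \<gamma>"
      unfolding loop_free_def
    proof (intro ballI impI)
      fix x y :: real
      assume xy: "x \<in> {0..1}" "y \<in> {0..1}" "\<gamma> x = \<gamma> y"
      consider "x = 1" "y = 1" | "x = 1" "y < 1" | "x < 1" "y = 1" | "x < 1" "y < 1"
        using xy(1,2) by fastforce
      then show "x = y \<or> x = 0 \<and> y = 1 \<or> x = 1 \<and> y = 0"
      proof cases
        case 2
        then have "\<gamma> y = \<gamma> 0" "y \<in> {0..<1}" using xy eq by simp_all
        then have "y = 0" by (intro inj_onD[OF inj]) simp_all
        with 2 show ?thesis by simp
      next
        case 3
        then have "\<gamma> x = \<gamma> 0" "x \<in> {0..<1}" using xy eq by simp_all
        then have "x = 0" by (intro inj_onD[OF inj]) simp_all
        with 3 show ?thesis by simp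
      next
        case 4
        then have "x \<in> {0..<1}" "y \<in> {0..<1}" using xy by simp_all
        then show ?thesis using inj_onD[OF inj xy(3)] by blast
      qed simp
    qed
  qed
  then show ?thesis
    unfolding simple_loop_def simple_path_def path_def pathfinish_def pathstart_def
    by (cases "\<gamma> 0 = \<gamma> 1") (simp_all add: eq_commute[of "\<gamma> 1"])
qed

end

theory Submission
  imports Defs
begin

text \<open>
  Four points \<open>a, b, c, d\<close> of \<open>\<real>\<^sup>3\<close> form a parallelogram as soon as they are distinct and
  \<open>a - b + c - d = 0\<close>, so inscribed parallelograms are zeros of the alternating sum
  \<open>\<gamma> a - \<gamma> b + \<gamma> c - \<gamma> d\<close> over cyclically ordered parameters \<open>a \<le> b \<le> c \<le> d \<le> a + 1\<close>. The idea is
  to cut down the 4-dimensional space of parameters to a 3-dimensional one on which a zero is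
  forced and automatically has four distinct vertices. The cut is the condition
  \<open>(b - a) + (d - c) = 1/2\<close>: if two neighbouring parameters of a zero coincide, the alternating sum
  reduces to a chord \<open>\<gamma> s - \<gamma> (s + 1/2)\<close>, which is nonzero because \<open>\<gamma>\<close> is injective.

  Why a zero is forced: the cut is a solid torus, namely a circle of positions \<open>\<tau>\<close> times a diamond
  of gap vectors \<open>(p, m)\<close>. The cyclic relabelling \<open>(a, b, c, d) \<mapsto> (b, c, d, a + 1)\<close> changes the sign
  of the alternating sum; on the torus it advances \<open>\<tau>\<close> by \<open>1/4\<close> and turns the diamond by a right
  angle. Consider the prism \<open>0 \<le> \<tau> \<le> 1/4\<close>. On its lateral boundary the sum is the chord
  \<open>\<gamma> s - \<gamma> (s + 1/2)\<close>, which is odd under \<open>s \<mapsto> s + 1/2\<close>, and its two end faces are matched with a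
  sign change by the relabelling. Hence the sum is odd for an antipodal involution on the boundary
  sphere of the prism, and it vanishes inside by a theorem of Borsuk-Ulam type
  (\<open>antipodal_zero\<close>, \<open>exists_balanced_quadruple\<close>).

  The Borsuk-Ulam step has a short proof by spinors. A nowhere zero field \<open>F\<close> on a compact convex set
  assigns to each point a complex line in \<open>\<complex>\<^sup>2\<close>, the positive eigenspace of the Pauli matrix of
  \<open>F x\<close>, and one can choose a nonzero vector \<open>g x\<close> in it continuously (\<open>spinor_lift\<close>). At
  antipodal boundary points \<open>F\<close> takes opposite values, so the two lines are different, and
  \<open>det (g x, g (- x))\<close> is a nowhere zero complex function on the sphere. Being antisymmetric it is
  odd, and such a function has no continuous logarithm; but on a sphere a logarithm exists.

  Density comes from the freedom of parametrization. If a chosen short arc takes up the parameter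
  interval \<open>[0, 3/4)\<close>, four parameters outside it lie in an interval of length \<open>1/4\<close> and
  cannot satisfy \<open>(b - a) + (d - c) = 1/2\<close> modulo 1, so one of the vertices lies on the arc
  (\<open>simple_loop_inscribed_quadruple\<close>, \<open>simple_loop_inscribed_vertex_near_start\<close>).
\<close>

section \<open>Spinors\<close>

text \<open>The Pauli matrix \<open>p\<^sub>1 \<sigma>\<^sub>1 + p\<^sub>2 \<sigma>\<^sub>2 + p\<^sub>3 \<sigma>\<^sub>3\<close> acting on \<open>\<complex>\<^sup>2\<close>. For a unit vector \<open>p\<close> it is an
  involution, and its fixed line is the point of the projective line that corresponds to \<open>p\<close> on the
  Riemann sphere; the fixed line of \<open>- p\<close> is the eigenspace for \<open>-1\<close>.\<close>

definition spin :: "real ^ 3 \<Rightarrow> complex \<times> complex \<Rightarrow> complex \<times> complex" where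
  "spin p z = (of_real (p $ 3) * fst z + Complex (p $ 1) (- (p $ 2)) * snd z,
               Complex (p $ 1) (p $ 2) * fst z - of_real (p $ 3) * snd z)"

lemma spin_add_left: "spin (p + q) z = spin p z + spin q z"
  by (simp add: spin_def prod_eq_iff complex_eq_iff algebra_simps)

lemma spin_add_right: "spin p (z + w) = spin p z + spin p w"
  by (simp add: spin_def prod_eq_iff algebra_simps)

lemma spin_minus_left: "spin (- p) z = - spin p z"
  by (simp add: spin_def prod_eq_iff complex_eq_iff algebra_simps)

lemma spin_zero_right [simp]: "spin p 0 = 0"
  by (simp add: spin_def prod_eq_iff)

lemma spin_spin: "spin p (spin p z) = (norm p)\<^sup>2 *\<^sub>R z"
proof -
  have "(norm p)\<^sup>2 = (p $ 1)\<^sup>2 + (p $ 2)\<^sup>2 + (p $ 3)\<^sup>2"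
    unfolding power2_norm_eq_inner by (simp add: inner_vec_def sum_3 power2_eq_square)
  then show ?thesis
    by (simp add: spin_def prod_eq_iff complex_eq_iff power2_eq_square algebra_simps)
qed

text \<open>Up to a factor 2, \<open>z \<mapsto> z + spin q z\<close> is for a unit vector \<open>q\<close> the orthogonal projection to the
  fixed line of \<open>q\<close>. It kills a vector of the fixed line of \<open>p\<close> only if that line is orthogonal
  to the one of \<open>q\<close>, which singles out \<open>q = - p\<close>.\<close>

lemma spin_step_nonzero:
  assumes "spin p z = z" "z \<noteq> 0" "q \<noteq> - p"
  shows "z + spin q z \<noteq> 0"
proof
  assume "z + spin q z = 0"
  then have "spin (p + q) z = 0"
    using assms(1) by (simp add: spin_add_left)
  then have "(norm (p + q))\<^sup>2 *\<^sub>R z = 0"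
    using spin_spin[of "p + q" z] by simp
  then have "q + p = 0"
    using assms(2) by (simp add: add.commute)
  then show False
    using assms(3) by (simp add: eq_neg_iff_add_eq_0)
qed

lemma spin_step_fixed:
  assumes "norm p = 1"
  shows "spin p (z + spin p z) = z + spin p z"
  using assms by (simp add: spin_add_right spin_spin add.commute)

lemma continuous_on_spin:
  assumes "continuous_on S f" "continuous_on S g"
  shows "continuous_on S (\<lambda>x. spin (f x) (g x))"
  unfolding spin_def Complex_eq by (intro continuous_intros assms)

text \<open>The projection to the fixed line is not zero, because its trace is not: the Pauli matrix has
  trace zero.\<close>

lemma exists_fixed_spinor:
  assumes "norm p = 1"
  shows "\<exists>z. z \<noteq> 0 \<and> spin p z = z"
proof -
  have "(1, 0) + spin p (1, 0) \<noteq> 0 \<or> (0, 1) + spin p (0, 1) \<noteq> 0"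
    by (auto simp: spin_def prod_eq_iff complex_eq_iff)
  then show ?thesis
    using spin_step_fixed[OF assms] by blast
qed

text \<open>Move from a base point \<open>x0\<close> to \<open>x\<close> along the segment in \<open>N\<close> equal steps, projecting the current
  spinor to the fixed line at each new point. For large \<open>N\<close> the field turns so little per step that
  no projection kills the spinor, by uniform continuity, and the outcome depends continuously
  on \<open>x\<close>.\<close>

lemma spinor_lift:
  fixes F :: "'a::real_normed_vector \<Rightarrow> real ^ 3"
  assumes K: "compact K" "convex K" and F: "continuous_on K F"
    and unit: "\<And>x. x \<in> K \<Longrightarrow> norm (F x) = 1"
  obtains g where "continuous_on K g" "\<And>x. x \<in> K \<Longrightarrow> g x \<noteq> 0 \<and> spin (F x) (g x) = g x"
proof (cases "K = {}")
  case True
  then show ?thesis using that[of "\<lambda>_. 0"] by simp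
next
  case False
  then obtain x0 where x0: "x0 \<in> K" by blast
  have "uniformly_continuous_on K F"
    using compact_uniformly_continuous[OF F K(1)] .
  then obtain d where d: "d > 0" "\<And>x y. \<lbrakk>x \<in> K; y \<in> K; dist y x < d\<rbrakk> \<Longrightarrow> dist (F y) (F x) < 1"
    unfolding uniformly_continuous_on_def by (meson zero_less_one)
  obtain D where D: "\<And>x. x \<in> K \<Longrightarrow> norm (x - x0) \<le> D"
    using compact_imp_bounded[OF K(1)] bounded_any_center[of K x0]
    by (auto simp: dist_norm norm_minus_commute)
  obtain N :: nat where N: "D / d < N"
    using reals_Archimedean2 by blast
  have D0: "D \<ge> 0" using D[OF x0] by simp
  then have Npos: "N > 0"
    using N d(1) by (metis divide_nonneg_pos gr0I not_le of_nat_0)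
  define P where "P k x = x0 + (real k / real N) *\<^sub>R (x - x0)" for k x
  have PK: "P k x \<in> K" if "x \<in> K" "k \<le> N" for k x
  proof -
    have "P k x = (1 - real k / real N) *\<^sub>R x0 + (real k / real N) *\<^sub>R x"
      by (simp add: P_def algebra_simps)
    moreover have "real k / real N \<le> 1" "real k / real N \<ge> 0"
      using that(2) Npos by simp_all
    ultimately show ?thesis
      using convexD_alt[OF K(2) x0 that(1)] by simp
  qed
  have close: "dist (P (Suc k) x) (P k x) < d" if "x \<in> K" for k x
  proof -
    have "P (Suc k) x - P k x = (1 / real N) *\<^sub>R (x - x0)"
      by (simp add: P_def algebra_simps add_divide_distrib)
    then have "dist (P (Suc k) x) (P k x) = norm (x - x0) / real N"
      by (simp add: dist_norm)
    also have "\<dots> \<le> D / real N"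
      using D[OF that] by (simp add: divide_right_mono)
    also have "\<dots> < d"
      using N Npos d(1) by (simp add: field_simps)
    finally show ?thesis .
  qed
  have "\<exists>g. continuous_on K g \<and> (\<forall>x\<in>K. g x \<noteq> 0 \<and> spin (F (P k x)) (g x) = g x)" if "k \<le> N" for k
    using that
  proof (induction k)
    case 0
    obtain z where "z \<noteq> 0" "spin (F x0) z = z"
      using exists_fixed_spinor[OF unit[OF x0]] by blast
    then show ?case
      by (intro exI[of _ "\<lambda>_. z"]) (simp add: P_def)
  next
    case (Suc k)
    then obtain g where g: "continuous_on K g"
        "\<And>x. x \<in> K \<Longrightarrow> g x \<noteq> 0 \<and> spin (F (P k x)) (g x) = g x"
      by auto
    define g' where "g' x = g x + spin (F (P (Suc k) x)) (g x)" for x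
    have "continuous_on K (P (Suc k))"
      unfolding P_def by (intro continuous_intros)
    then have "continuous_on K (\<lambda>x. F (P (Suc k) x))"
      using PK[OF _ Suc.prems] by (intro continuous_on_compose2[OF F]) auto
    then have "continuous_on K g'"
      unfolding g'_def by (intro continuous_intros continuous_on_spin g(1))
    moreover have "g' x \<noteq> 0 \<and> spin (F (P (Suc k) x)) (g' x) = g' x" if x: "x \<in> K" for x
    proof -
      have Pk: "P k x \<in> K" "P (Suc k) x \<in> K"
        using PK x Suc.prems by auto
      have "F (P (Suc k) x) \<noteq> - F (P k x)"
      proof
        assume "F (P (Suc k) x) = - F (P k x)"
        then have "dist (F (P (Suc k) x)) (F (P k x)) = norm (- (2 *\<^sub>R F (P k x)))"
          by (simp add: dist_norm scaleR_2)
        then show False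
          using d(2)[OF Pk close[OF x]] unit[OF Pk(1)] by simp
      qed
      then show ?thesis
        unfolding g'_def using spin_step_nonzero spin_step_fixed[OF unit[OF Pk(2)]] g(2)[OF x]
        by blast
    qed
    ultimately show ?case by blast
  qed
  from this[of N] obtain g where "continuous_on K g"
      "\<And>x. x \<in> K \<Longrightarrow> g x \<noteq> 0 \<and> spin (F (P N x)) (g x) = g x"
    by auto
  moreover have "P N x = x" for x
    using Npos by (simp add: P_def)
  ultimately show ?thesis using that by metis
qed

section \<open>A Borsuk-Ulam theorem for maps to space\<close>

definition spinor_det :: "complex \<times> complex \<Rightarrow> complex \<times> complex \<Rightarrow> complex" where
  "spinor_det z w = fst z * snd w - snd z * fst w"

lemma spinor_det_swap: "spinor_det w z = - spinor_det z w"
  by (simp add: spinor_det_def)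

text \<open>The eigenlines of a Pauli matrix for \<open>1\<close> and \<open>-1\<close> meet only in zero, so vectors from
  the two are linearly independent.\<close>

lemma spinor_det_nonzero:
  assumes z: "spin p z = z" "z \<noteq> 0" and w: "spin (- p) w = w" "w \<noteq> 0"
  shows "spinor_det z w \<noteq> 0"
proof
  assume det: "spinor_det z w = 0"
  obtain k where k: "w = (k * fst z, k * snd z)"
  proof (cases "fst z = 0")
    case True
    then have "snd z \<noteq> 0" using z(2) by (simp add: prod_eq_iff)
    then show ?thesis
      using det True that[of "snd w / snd z"] by (simp add: spinor_det_def prod_eq_iff)
  next
    case False
    then show ?thesis
      using det that[of "fst w / fst z"] by (simp add: spinor_det_def prod_eq_iff field_simps)
  qed
  have "spin p w = (k * fst (spin p z), k * snd (spin p z))"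
    by (simp add: k spin_def algebra_simps)
  then have "spin p w = w"
    using z(1) k by simp
  then have "w + w = 0"
    using w(1) spin_minus_left[of p w] by (metis add.right_inverse)
  then have "w = 0"
    by (simp add: prod_eq_iff)
  then show False using w(2) by simp
qed

text \<open>Different logarithms of one number are at least \<open>2 \<pi>\<close> apart.\<close>

lemma exp_eq_imp_constant:
  fixes f :: "'a::topological_space \<Rightarrow> complex"
  assumes S: "connected S" "continuous_on S f" and e: "\<And>x. x \<in> S \<Longrightarrow> exp (f x) = c"
    and xy: "x \<in> S" "y \<in> S"
  shows "f x = f y"
proof -
  have "f constant_on S"
  proof (rule continuous_discrete_range_constant[OF S])
    fix x assume x: "x \<in> S"
    have "2 * pi \<le> cmod (f y - f x)" if y: "y \<in> S" "f y \<noteq> f x" for y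
    proof -
      have "exp (f y) = exp (f x)" using e x y by simp
      then obtain n :: int where n: "f y = f x + (of_int (2 * n) * pi) * \<i>"
        using exp_eq by blast
      then have "n \<noteq> 0" using y(2) by auto
      have "cmod (f y - f x) = 2 * pi * \<bar>of_int n\<bar>"
        by (simp add: n norm_mult)
      moreover have "1 \<le> \<bar>real_of_int n\<bar>" using \<open>n \<noteq> 0\<close> by linarith
      ultimately show ?thesis by (metis mult.right_neutral mult_left_mono pi_ge_zero mult_nonneg_nonneg zero_le_numeral)
    qed
    then show "\<exists>e>0. \<forall>y. y \<in> S \<and> f y \<noteq> f x \<longrightarrow> e \<le> cmod (f y - f x)"
      by (intro exI[of _ "2 * pi"]) auto
  qed
  then show ?thesis
    using xy unfolding constant_on_def by metis
qed

text \<open>Here \<open>q\<close> is a sphere in \<open>K\<close>, given by longitude \<open>s\<close> (with period 1) and latitude \<open>h\<close>; the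
  antipodal map is \<open>(s, h) \<mapsto> (s + 1/2, - h)\<close>. The sphere need not be embedded, and only the values
  of \<open>F\<close> have to be odd. If \<open>F\<close> has no zero, the determinant \<open>L\<close> of the spinors at antipodal points
  has a logarithm \<open>m\<close> on the strip, and \<open>m\<close> changes by a constant logarithm \<open>c\<close> of \<open>-1\<close> under the
  antipodal map. Applying that map twice is a full turn in longitude, which changes \<open>m\<close> by \<open>2 c\<close>. At
  the pole \<open>L\<close> is constant, hence so is \<open>m\<close>, and \<open>c = 0\<close> contradicts \<open>exp c = -1\<close>.\<close>

theorem antipodal_zero:
  fixes F :: "'a::real_normed_vector \<Rightarrow> real ^ 3" and q :: "real \<times> real \<Rightarrow> 'a"
  assumes K: "compact K" "convex K" and F: "continuous_on K F"
    and H: "H \<ge> 0"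
    and q: "continuous_on (UNIV \<times> {-H..H}) q" "q ` (UNIV \<times> {-H..H}) \<subseteq> K"
    and period: "\<And>s h. q (s + 1, h) = q (s, h)"
    and poles: "\<And>s. q (s, H) = N" "\<And>s. q (s, -H) = S"
    and odd: "\<And>s h. h \<in> {-H..H} \<Longrightarrow> F (q (s + 1/2, - h)) = - F (q (s, h))"
  shows "\<exists>x\<in>K. F x = 0"
proof (rule ccontr)
  assume "\<not> ?thesis"
  then have nz: "F x \<noteq> 0" if "x \<in> K" for x using that by blast
  have "continuous_on K (\<lambda>x. sgn (F x))"
    using nz by (intro continuous_on_sgn F) auto
  then obtain g where g: "continuous_on K g"
      "\<And>x. x \<in> K \<Longrightarrow> g x \<noteq> 0 \<and> spin (sgn (F x)) (g x) = g x"
    using spinor_lift[OF K, of "\<lambda>x. sgn (F x)"] nz by (auto simp: norm_sgn)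
  define U :: "(real \<times> real) set" where "U = UNIV \<times> {-H..H}"
  define \<iota> :: "real \<times> real \<Rightarrow> real \<times> real" where "\<iota> = (\<lambda>(s, h). (s + 1/2, - h))"
  have \<iota>U: "\<iota> x \<in> U" if "x \<in> U" for x
    using that by (auto simp: \<iota>_def U_def)
  have \<iota>c: "continuous_on U \<iota>"
    unfolding \<iota>_def case_prod_unfold by (intro continuous_intros)
  have qK: "q x \<in> K" if "x \<in> U" for x
    using that q(2) by (auto simp: U_def)
  have gc: "continuous_on U (\<lambda>x. g (q x))"
    using q qK by (intro continuous_on_compose2[OF g(1)]) (auto simp: U_def)
  have gc': "continuous_on U (\<lambda>x. g (q (\<iota> x)))"
    using \<iota>U by (intro continuous_on_compose2[OF gc \<iota>c]) auto
  define L where "L x = spinor_det (g (q x)) (g (q (\<iota> x)))" for x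
  have Lc: "continuous_on U L"
    unfolding L_def spinor_det_def by (intro continuous_intros gc gc')
  have Lnz: "L x \<noteq> 0" if x: "x \<in> U" for x
  proof -
    have "F (q (\<iota> x)) = - F (q x)"
      using odd x by (auto simp: U_def \<iota>_def)
    then have "sgn (F (q (\<iota> x))) = - sgn (F (q x))"
      by (simp add: sgn_minus)
    then show ?thesis
      unfolding L_def using g(2)[OF qK[OF x]] g(2)[OF qK[OF \<iota>U[OF x]]]
      by (intro spinor_det_nonzero[where p = "sgn (F (q x))"]) auto
  qed
  have Lodd: "L (\<iota> x) = - L x" for x
  proof -
    have "q (\<iota> (\<iota> x)) = q x"
      using period[of "fst x" "snd x"] by (simp add: \<iota>_def case_prod_unfold add.commute)
    then show ?thesis
      unfolding L_def by (metis spinor_det_swap)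
  qed
  have convU: "convex U"
    unfolding U_def by (intro convex_Times) auto
  then obtain m where m: "continuous_on U m" "\<And>x. x \<in> U \<Longrightarrow> L x = exp (m x)"
    using continuous_logarithm_on_contractible[OF Lc convex_imp_contractible Lnz] by metis
  have c_exp: "exp (m (\<iota> x) - m x) = -1" if "x \<in> U" for x
  proof -
    have "exp (m (\<iota> x) - m x) = L (\<iota> x) / L x"
      using m(2)[OF that] m(2)[OF \<iota>U[OF that]] by (simp add: exp_diff)
    then show ?thesis using Lodd Lnz[OF that] by simp
  qed
  have c_cont: "continuous_on U (\<lambda>x. m (\<iota> x) - m x)"
    using \<iota>U by (intro continuous_intros m(1) continuous_on_compose2[OF m(1) \<iota>c]) auto
  have c_const: "m (\<iota> x) - m x = m (\<iota> y) - m y" if "x \<in> U" "y \<in> U" for x y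
    using exp_eq_imp_constant[OF convex_connected[OF convU] c_cont c_exp that] .
  let ?x = "(0, H)"
  have xU: "(s, H) \<in> U" for s
    using H by (simp add: U_def)
  have "m (0, H) = m (1, H)"
  proof -
    have "continuous_on UNIV (\<lambda>s. m (s, H))"
      using xU by (intro continuous_on_compose2[OF m(1)] continuous_intros) auto
    moreover have "exp (m (s, H)) = L (0, H)" for s
      using m(2)[OF xU[of s]] m(2)[OF xU[of 0]] poles
      by (simp add: L_def \<iota>_def)
    ultimately show ?thesis
      using exp_eq_imp_constant[OF connected_UNIV, of "\<lambda>s. m (s, H)"] by blast
  qed
  moreover have "\<iota> (\<iota> ?x) = (1, H)"
    by (simp add: \<iota>_def)
  ultimately have "m (\<iota> (\<iota> ?x)) = m ?x" by simp
  then have "m (\<iota> ?x) - m ?x = - (m (\<iota> ?x) - m ?x)"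
    using c_const[OF \<iota>U[OF xU[of 0]] xU[of 0]] by (simp add: algebra_simps)
  then have "m (\<iota> ?x) - m ?x = 0"
    by (simp add: eq_neg_iff_add_eq_0 flip: mult_2)
  then show False
    using c_exp[OF xU[of 0]] by simp
qed

section \<open>Balanced quadruples on a closed curve\<close>

text \<open>The quadruples \<open>a \<le> b \<le> c \<le> d \<le> a + 1\<close> with \<open>(b - a) + (d - c) = 1/2\<close> are exactly
  \<open>(\<tau> - p, \<tau> + 1/4 + m, \<tau> + 1/2 + p, \<tau> + 3/4 - m)\<close> with \<open>(p, m)\<close> in the diamond
  \<open>\<bar>p\<bar> + \<bar>m\<bar> \<le> 1/4\<close>: the four gaps are \<open>1/4 \<plusminus> p \<plusminus> m\<close>, one for each choice of signs. In these coordinates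
  cyclic relabelling is \<open>(\<tau>, p, m) \<mapsto> (\<tau> + 1/4, - m, p)\<close>.\<close>

definition alternating_sum :: "(real \<Rightarrow> real ^ 3) \<Rightarrow> real \<times> real \<times> real \<Rightarrow> real ^ 3" where
  "alternating_sum G = (\<lambda>(\<tau>, p, m). G (\<tau> - p) - G (\<tau> + 1/4 + m) + G (\<tau> + 1/2 + p) - G (\<tau> + 3/4 - m))"

definition gap_diamond :: "(real \<times> real) set" where
  "gap_diamond = {(p, m). \<bar>p\<bar> + \<bar>m\<bar> \<le> 1/4}"

lemma compact_gap_diamond: "compact gap_diamond"
proof -
  have "closed gap_diamond"
    unfolding gap_diamond_def case_prod_unfold
    by (intro closed_Collect_le continuous_intros)
  moreover have "gap_diamond \<subseteq> {-1..1} \<times> {-1..1}"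
    by (auto simp: gap_diamond_def)
  then have "bounded gap_diamond"
    by (rule bounded_subset[rotated]) (intro bounded_Times bounded_closed_interval)
  ultimately show ?thesis
    by (simp add: compact_eq_bounded_closed)
qed

lemma convex_gap_diamond: "convex gap_diamond"
proof (rule convexI)
  fix x y :: "real \<times> real" and u v :: real
  assume xy: "x \<in> gap_diamond" "y \<in> gap_diamond" and uv: "0 \<le> u" "0 \<le> v" "u + v = 1"
  have "\<bar>u * fst x + v * fst y\<bar> \<le> u * \<bar>fst x\<bar> + v * \<bar>fst y\<bar>"
    using abs_triangle_ineq[of "u * fst x" "v * fst y"] uv by (simp add: abs_mult)
  moreover have "\<bar>u * snd x + v * snd y\<bar> \<le> u * \<bar>snd x\<bar> + v * \<bar>snd y\<bar>"
    using abs_triangle_ineq[of "u * snd x" "v * snd y"] uv by (simp add: abs_mult)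
  ultimately have "\<bar>u * fst x + v * fst y\<bar> + \<bar>u * snd x + v * snd y\<bar>
      \<le> u * (\<bar>fst x\<bar> + \<bar>snd x\<bar>) + v * (\<bar>fst y\<bar> + \<bar>snd y\<bar>)"
    by (simp add: algebra_simps)
  also have "\<dots> \<le> u * (1/4) + v * (1/4)"
    using xy uv by (intro add_mono mult_left_mono) (auto simp: gap_diamond_def)
  also have "\<dots> = 1/4"
    using uv by (simp flip: distrib_right)
  finally show "u *\<^sub>R x + v *\<^sub>R y \<in> gap_diamond"
    by (simp add: gap_diamond_def case_prod_unfold)
qed

text \<open>The triangle wave of period 1 and amplitude \<open>1/4\<close>, with its maximum at 0. It plays the role
  of the cosine for the diamond: \<open>s \<mapsto> (triangle_wave (s + 1/4), triangle_wave s)\<close> runs once around the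
  boundary, and advancing \<open>s\<close> by \<open>1/4\<close> is a rotation by a right angle.\<close>

definition triangle_wave :: "real \<Rightarrow> real" where
  "triangle_wave x = arcsin (cos (2 * pi * x)) / (2 * pi)"

lemma triangle_wave_half: "triangle_wave (x + 1/2) = - triangle_wave x"
proof -
  have "cos (2 * pi * (x + 1/2)) = - cos (2 * pi * x)"
    by (simp add: distrib_left)
  then show ?thesis
    by (simp add: triangle_wave_def arcsin_minus)
qed

lemma triangle_wave_period: "triangle_wave (x + 1) = triangle_wave x"
proof -
  have "x + 1 = x + 1/2 + 1/2" by simp
  then show ?thesis by (simp only: triangle_wave_half minus_minus)
qed

lemma triangle_wave_linear:
  assumes "0 \<le> x" "x \<le> 1/2"
  shows "triangle_wave x = 1/4 - x"
proof -
  have "cos (2 * pi * x) = sin (pi / 2 - 2 * pi * x)"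
    by (simp add: sin_diff)
  moreover have "2 * pi * x \<le> pi" "0 \<le> 2 * pi * x"
    using assms by (simp_all add: mult_le_cancel_left)
  ultimately have "arcsin (cos (2 * pi * x)) = pi / 2 - 2 * pi * x"
    by (simp add: arcsin_sin)
  then show ?thesis
    by (simp add: triangle_wave_def diff_divide_distrib)
qed

lemma continuous_on_triangle_wave [continuous_intros]:
  fixes f :: "'a::t2_space \<Rightarrow> real"
  assumes "continuous_on A f"
  shows "continuous_on A (\<lambda>x. triangle_wave (f x))"
  unfolding triangle_wave_def by (intro continuous_intros assms) auto

text \<open>Statements about the boundary of the diamond that are compatible with the rotation need to be
  checked on one edge only.\<close>

lemma quarter_turn_induct:
  fixes P :: "real \<Rightarrow> bool"
  assumes base: "\<And>x. 0 \<le> x \<Longrightarrow> x \<le> 1/4 \<Longrightarrow> P x"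
    and step: "\<And>x. P (x + 1/4) \<longleftrightarrow> P x"
  shows "P x"
proof -
  have shift: "P (y + of_int k / 4) \<longleftrightarrow> P y" for y and k :: int
  proof (induction k rule: int_induct[where k = 0])
    case (step1 i)
    then show ?case using step[of "y + of_int i / 4"] by (simp add: add_divide_distrib add.assoc)
  next
    case (step2 i)
    then show ?case using step[of "y + of_int (i - 1) / 4"] by (simp add: diff_divide_distrib)
  qed simp
  have "P (frac (4 * x) / 4)"
    using frac_ge_0[of "4 * x"] frac_lt_1[of "4 * x"] by (intro base) auto
  then have "P (frac (4 * x) / 4 + of_int \<lfloor>4 * x\<rfloor> / 4)"
    using shift by blast
  moreover have "frac (4 * x) / 4 + of_int \<lfloor>4 * x\<rfloor> / 4 = x"
    by (simp add: frac_def field_simps)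
  ultimately show ?thesis by simp
qed

lemma triangle_wave_in_diamond: "(triangle_wave (x + 1/4), triangle_wave x) \<in> gap_diamond"
proof (induction x rule: quarter_turn_induct)
  case (1 x)
  then show ?case by (simp add: triangle_wave_linear gap_diamond_def)
next
  case (2 x)
  have "triangle_wave (x + 1/4 + 1/4) = - triangle_wave x"
    using triangle_wave_half[of x] by (simp add: add.assoc)
  then show ?case by (simp add: gap_diamond_def add.commute)
qed

context
  fixes G :: "real \<Rightarrow> real ^ 3"
  assumes period: "\<And>x. G (x + 1) = G x"
begin

lemma alternating_sum_quarter_turn:
  "alternating_sum G (\<tau> + 1/4, - m, p) = - alternating_sum G (\<tau>, p, m)"
  using period[of "\<tau> - p"] by (simp add: alternating_sum_def algebra_simps)

text \<open>On an edge of the diamond one gap closes and its two terms cancel; the other two parameters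
  then differ by \<open>1/2\<close>. What matters is that the remaining chord depends on \<open>\<tau> + x\<close> alone, so the
  lateral boundary of the prism collapses to a circle.\<close>

lemma alternating_sum_boundary:
  "alternating_sum G (\<tau>, triangle_wave (x + 1/4), triangle_wave x) = G (\<tau> + x) - G (\<tau> + x + 1/2)"
proof (induction x arbitrary: \<tau> rule: quarter_turn_induct)
  case (1 x)
  then show ?case
    by (simp add: triangle_wave_linear alternating_sum_def algebra_simps)
next
  case (2 x)
  let ?p = "triangle_wave (x + 1/4)" and ?m = "triangle_wave x"
  have "triangle_wave (x + 1/4 + 1/4) = - ?m"
    using triangle_wave_half[of x] by (simp add: add.assoc)
  then have turn: "alternating_sum G (\<tau> + 1/4, triangle_wave (x + 1/4 + 1/4), triangle_wave (x + 1/4))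
      = - alternating_sum G (\<tau>, ?p, ?m)" for \<tau>
    by (simp add: alternating_sum_quarter_turn)
  have G: "G (\<tau> + 1/4 + (x + 1/4)) - G (\<tau> + 1/4 + (x + 1/4) + 1/2) = - (G (\<tau> + x) - G (\<tau> + x + 1/2))" for \<tau>
    using period[of "\<tau> + x"] by (simp add: algebra_simps)
  show ?case
  proof
    assume *: "\<forall>\<tau>. alternating_sum G (\<tau>, triangle_wave (x + 1/4 + 1/4), triangle_wave (x + 1/4))
        = G (\<tau> + (x + 1/4)) - G (\<tau> + (x + 1/4) + 1/2)"
    show "\<forall>\<tau>. alternating_sum G (\<tau>, ?p, ?m) = G (\<tau> + x) - G (\<tau> + x + 1/2)"
      using * turn G by (metis neg_equal_iff_equal)
  next
    assume *: "\<forall>\<tau>. alternating_sum G (\<tau>, ?p, ?m) = G (\<tau> + x) - G (\<tau> + x + 1/2)"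
    show "\<forall>\<tau>. alternating_sum G (\<tau>, triangle_wave (x + 1/4 + 1/4), triangle_wave (x + 1/4))
        = G (\<tau> + (x + 1/4)) - G (\<tau> + (x + 1/4) + 1/2)"
    proof
      fix \<tau>
      show "alternating_sum G (\<tau>, triangle_wave (x + 1/4 + 1/4), triangle_wave (x + 1/4))
        = G (\<tau> + (x + 1/4)) - G (\<tau> + (x + 1/4) + 1/2)"
        using * turn[of "\<tau> - 1/4"] G[of "\<tau> - 1/4"] by simp
    qed
  qed
qed

end

text \<open>The sphere to which \<open>antipodal_zero\<close> is applied is the boundary of the prism
  \<open>0 \<le> \<tau> \<le> 1/4\<close>, parametrized by longitude \<open>s\<close> and latitude \<open>h\<close> in \<open>[-2, 2]\<close>. For \<open>h \<le> -1\<close> and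
  \<open>h \<ge> 1\<close> the point lies in the bottom and the top face, at fraction \<open>r h\<close> of the way from the centre
  to the edge; in between, it climbs the lateral boundary. The boundary parameter \<open>s - \<tau> h\<close> is chosen
  so that the alternating sum on the lateral boundary depends on \<open>s\<close> only.\<close>

theorem exists_balanced_quadruple:
  fixes G :: "real \<Rightarrow> real ^ 3"
  assumes G: "continuous_on UNIV G" and period: "\<And>x. G (x + 1) = G x"
  obtains a b c d where "a \<le> b" "b \<le> c" "c \<le> d" "d \<le> a + 1"
    "(b - a) + (d - c) = 1/2" "G b - G a = G c - G d"
proof -
  let ?K = "{0..1/4::real} \<times> gap_diamond"
  define \<tau> r :: "real \<Rightarrow> real"
    where "\<tau> h = (max (-1) (min 1 h) + 1) / 8" and "r h = min 1 (2 - \<bar>h\<bar>)" for h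
  define q where "q = (\<lambda>(s, h). (\<tau> h, r h * triangle_wave (s - \<tau> h + 1/4), r h * triangle_wave (s - \<tau> h)))"
  have "\<exists>x\<in>?K. alternating_sum G x = 0"
  proof (rule antipodal_zero[where q = q and H = 2 and N = "(1/4, 0, 0)" and S = "(0, 0, 0)"])
    show "compact ?K"
      by (intro compact_Times compact_gap_diamond) auto
    show "convex ?K"
      by (intro convex_Times convex_gap_diamond) auto
    show "continuous_on ?K (alternating_sum G)"
      unfolding alternating_sum_def case_prod_unfold
      by (intro continuous_intros continuous_on_compose2[OF G]) auto
    show "continuous_on (UNIV \<times> {-2..2}) q"
      unfolding q_def \<tau>_def r_def case_prod_unfold by (intro continuous_intros) auto
    show "q ` (UNIV \<times> {-2..2}) \<subseteq> ?K"
    proof (rule image_subsetI)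
      fix x :: "real \<times> real" assume "x \<in> UNIV \<times> {-2..2}"
      then obtain s h where x: "x = (s, h)" and h: "h \<in> {-2..2}" by blast
      have "\<tau> h \<in> {0..1/4}" by (auto simp: \<tau>_def)
      moreover have r: "0 \<le> r h" "r h \<le> 1" using h by (auto simp: r_def)
      moreover have "r h * \<bar>triangle_wave (s - \<tau> h + 1/4)\<bar> + r h * \<bar>triangle_wave (s - \<tau> h)\<bar> \<le> 1 * (1/4)"
        unfolding distrib_left[symmetric] using r triangle_wave_in_diamond[of "s - \<tau> h"]
        by (intro mult_mono) (auto simp: gap_diamond_def)
      ultimately show "q x \<in> ?K"
        by (simp add: x q_def gap_diamond_def abs_mult)
    qed
    show "q (s + 1, h) = q (s, h)" for s h
      using triangle_wave_period[of "s - \<tau> h + 1/4"] triangle_wave_period[of "s - \<tau> h"]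
      by (simp add: q_def algebra_simps)
    show "q (s, 2) = (1/4, 0, 0)" "q (s, -2) = (0, 0, 0)" for s
      by (simp_all add: q_def \<tau>_def r_def)
    show "alternating_sum G (q (s + 1/2, - h)) = - alternating_sum G (q (s, h))" if "h \<in> {-2..2}" for s h
    proof -
      \<comment> \<open>The antipode of a point of the bottom face is its cyclic relabelling in the top face.\<close>
      have lower: "alternating_sum G (q (s + 1/2, - h)) = - alternating_sum G (q (s, h))" if "h \<le> -1" for s h
      proof -
        have \<tau>r: "\<tau> h = 0" "\<tau> (- h) = 1/4" "r (- h) = r h"
          using that by (simp_all add: \<tau>_def r_def)
        have "s + 1/2 - 1/4 + 1/4 = s + 1/2" "s + 1/2 - 1/4 = s + 1/4" by simp_all
        then have "q (s + 1/2, - h) = (0 + 1/4, - (r h * triangle_wave s), r h * triangle_wave (s + 1/4))"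
          by (simp only: q_def case_prod_conv \<tau>r triangle_wave_half) simp
        moreover have "q (s, h) = (0, r h * triangle_wave (s + 1/4), r h * triangle_wave s)"
          by (simp add: q_def \<tau>r)
        ultimately show ?thesis
          by (simp only: alternating_sum_quarter_turn[of G, OF period])
      qed
      consider "h \<le> -1" | "-1 \<le> h" "h \<le> 1" | "h \<ge> 1" by linarith
      then show ?thesis
      proof cases
        case 1
        then show ?thesis by (rule lower)
      next
        case 2
        then have "r h = 1" "r (- h) = 1" by (auto simp: r_def)
        then have "alternating_sum G (q (s, h)) = G s - G (s + 1/2)"
            "alternating_sum G (q (s + 1/2, - h)) = G (s + 1/2) - G (s + 1/2 + 1/2)"
          using alternating_sum_boundary[of G "\<tau> h" "s - \<tau> h", OF period]
            alternating_sum_boundary[of G "\<tau> (- h)" "s + 1/2 - \<tau> (- h)", OF period]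
          by (simp_all add: q_def add.assoc)
        then show ?thesis
          using period[of s] by (simp add: add.commute)
      next
        case 3
        have "q (s, h) = q (s + 1/2 + 1/2, h)"
          using \<open>\<And>s h. q (s + 1, h) = q (s, h)\<close>[of s h] by (simp add: add.commute)
        then show ?thesis
          using lower[of "- h" "s + 1/2"] 3 by simp
      qed
    qed
  qed simp
  then obtain t p m where "\<bar>p\<bar> + \<bar>m\<bar> \<le> 1/4" "alternating_sum G (t, p, m) = 0"
    by (auto simp: gap_diamond_def)
  then show ?thesis
    by (intro that[of "t - p" "t + 1/4 + m" "t + 1/2 + p" "t + 3/4 - m"])
      (auto simp: alternating_sum_def algebra_simps)
qed

section \<open>Inscribed parallelograms\<close>

text \<open>A flat parallelogram is opened up by moving \<open>b\<close> and \<open>d\<close> in opposite directions off the line.\<close>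

lemma degenerate_parallelogramI:
  fixes a b c d :: "'a::euclidean_space"
  assumes dim: "DIM('a) \<ge> 2" and dist: "distinct [a, b, c, d]"
    and sum: "b - a = c - d" and col: "collinear {a, b, c}"
  shows "degenerate_parallelogram a b c d"
proof -
  define v where "v = c - a"
  have v: "v \<noteq> 0" using dist by (auto simp: v_def)
  have "span {v} \<noteq> UNIV"
  proof
    assume "span {v} = UNIV"
    then have "DIM('a) \<le> card {v}"
      by (metis dim_UNIV dim_le_card finite.emptyI finite.insertI top_greatest)
    then show False using dim by simp
  qed
  then obtain e where e: "e \<notin> span {v}" by blast
  obtain k where b: "b - a = k *\<^sub>R v"
  proof -
    obtain u where "b = u *\<^sub>R a + (1 - u) *\<^sub>R c"
      using col dist unfolding collinear_3_expand by auto
    then have "b - a = (1 - u) *\<^sub>R v"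
      by (simp add: v_def algebra_simps)
    then show ?thesis using that by blast
  qed
  have d: "d - a = (1 - k) *\<^sub>R v"
    using sum b by (simp add: v_def algebra_simps)
  have "collinear {a, b, c, d}"
    unfolding collinear_alt
  proof (rule exI, rule exI, rule ballI)
    fix x assume "x \<in> {a, b, c, d}"
    moreover have "a = a + 0 *\<^sub>R v" "b = a + k *\<^sub>R v" "c = a + 1 *\<^sub>R v" "d = a + (1 - k) *\<^sub>R v"
      using b d by (simp_all add: v_def algebra_simps)
    ultimately show "\<exists>t. x = a + t *\<^sub>R v" by blast
  qed
  moreover define w where "w n = inverse (real (Suc n)) *\<^sub>R e" for n
  have w0: "w \<longlonglongrightarrow> 0"
    unfolding w_def using tendsto_scaleR[OF LIMSEQ_inverse_real_of_nat tendsto_const[of e]] by simp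
  have "\<not> collinear {a, b + w n, c}" for n
  proof
    assume "collinear {a, b + w n, c}"
    then obtain u where "b + w n = u *\<^sub>R a + (1 - u) *\<^sub>R c"
      using dist unfolding collinear_3_expand by auto
    then have "w n = (1 - u) *\<^sub>R v - (b - a)"
      by (simp add: v_def algebra_simps)
    then have "w n = (1 - u - k) *\<^sub>R v"
      unfolding b by (simp add: scaleR_diff_left)
    moreover have "e = real (Suc n) *\<^sub>R w n"
      by (simp add: w_def)
    ultimately have "e = (real (Suc n) * (1 - u - k)) *\<^sub>R v"
      by simp
    then show False
      using e by (metis span_base span_scale singletonI)
  qed
  then have "nondegenerate_parallelogram a (b + w n) c (d - w n)" for n
    using sum by (simp add: nondegenerate_parallelogram_def algebra_simps)
  moreover have "(\<lambda>n. b + w n) \<longlonglongrightarrow> b" "(\<lambda>n. d - w n) \<longlonglongrightarrow> d"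
    using tendsto_add[OF tendsto_const w0] tendsto_diff[OF tendsto_const w0] by simp_all
  ultimately show ?thesis
    unfolding degenerate_parallelogram_def using dist
    by (intro conjI exI[of _ "\<lambda>_. a"] exI[of _ "\<lambda>n. b + w n"] exI[of _ "\<lambda>_. c"] exI[of _ "\<lambda>n. d - w n"])
      auto
qed

text \<open>On each interval between neighbouring integers the extension is a translate of \<open>f\<close>, including
  at the right end because \<open>f 0 = f 1\<close>, and these pieces are glued.\<close>

lemma continuous_on_periodic_extension:
  fixes f :: "real \<Rightarrow> 'a::topological_space"
  assumes f: "continuous_on {0..1} f" "f 0 = f 1"
  shows "continuous_on UNIV (\<lambda>x. f (frac x))"
proof -
  let ?f = "\<lambda>x. f (frac x)"
  have piece: "continuous_on {of_int k..of_int k + 1} ?f" for k :: int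
  proof -
    have "continuous_on {of_int k..of_int k + 1} (\<lambda>x::real. f (x - of_int k))"
      by (intro continuous_on_compose2[OF f(1)] continuous_intros) auto
    moreover have "f (frac x) = f (x - of_int k)" if "x \<in> {of_int k..of_int k + 1}" for x :: real
    proof (cases "x = of_int k + 1")
      case True
      then show ?thesis using f(2) by (simp add: frac_def)
    next
      case False
      then have "\<lfloor>x\<rfloor> = k" using that by (intro floor_unique) auto
      then show ?thesis by (simp add: frac_def)
    qed
    ultimately show ?thesis
      using continuous_on_cong[OF refl, of "{of_int k..of_int k + 1}" ?f "\<lambda>x. f (x - of_int k)"] by simp
  qed
  have "isCont ?f x" for x
  proof -
    define k where "k = \<lfloor>x\<rfloor>"
    have "continuous_on ({of_int (k - 1)..of_int (k - 1) + 1} \<union> {of_int k..of_int k + 1}) ?f"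
      by (intro continuous_on_closed_Un piece) auto
    moreover have "{of_int k - 1<..<of_int k + 1} \<subseteq> {of_int (k - 1)..of_int (k - 1) + 1} \<union> {of_int k..of_int k + (1::real)}"
      by auto
    ultimately have "continuous_on {of_int k - 1<..<of_int k + 1} ?f"
      by (rule continuous_on_subset)
    moreover have "x \<in> {of_int k - 1<..<of_int k + 1}"
      unfolding k_def using floor_correct[of x] by simp linarith
    ultimately show ?thesis
      by (metis continuous_on_eq_continuous_at open_greaterThanLessThan)
  qed
  then show ?thesis by (simp add: continuous_on_eq_continuous_at)
qed

text \<open>A balanced quadruple on an injective loop has no coinciding neighbours: if one gap is 0, the
  balance equation turns into the vanishing of a chord between parameters at distance \<open>1/2\<close>. And if all four
  parameters had fractional parts in \<open>[3/4, 1)\<close>, the two differences \<open>b - a\<close> and \<open>d - c\<close> would each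
  be within less than \<open>1/4\<close> of an integer, so that their sum could not be \<open>1/2\<close>.\<close>

lemma simple_loop_inscribed_quadruple:
  fixes \<gamma> :: "real \<Rightarrow> real ^ 3"
  assumes \<gamma>: "simple_loop \<gamma>"
  obtains w x y z where "{w, x, y, z} \<subseteq> {0..<1}" "w < 3/4 \<or> x < 3/4 \<or> y < 3/4 \<or> z < 3/4"
    "parallelogram (\<gamma> w) (\<gamma> x) (\<gamma> y) (\<gamma> z)"
proof -
  define G where "G x = \<gamma> (frac x)" for x
  have cont: "continuous_on {0..1} \<gamma>" "\<gamma> 0 = \<gamma> 1" and inj: "inj_on \<gamma> {0..<1}"
    using \<gamma> by (auto simp: simple_loop_iff)
  have "continuous_on UNIV G"
    unfolding G_def using continuous_on_periodic_extension[OF cont] .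
  moreover have "G (x + 1) = G x" for x
    by (simp add: G_def frac_1_eq)
  ultimately obtain a b c d where le: "a \<le> b" "b \<le> c" "c \<le> d" "d \<le> a + 1"
    and half: "(b - a) + (d - c) = 1/2" and sum: "G b - G a = G c - G d"
    using exists_balanced_quadruple by metis
  have frac01: "frac x \<in> {0..<1}" for x :: real
    using frac_ge_0 frac_lt_1 by auto
  have G_eq: "G x = G y \<longleftrightarrow> x - y \<in> \<int>" for x y
  proof -
    have "G x = G y \<longleftrightarrow> frac x = frac y"
      unfolding G_def using inj_on_eq_iff[OF inj frac01 frac01] .
    also have "\<dots> \<longleftrightarrow> x - y \<in> \<int>"
    proof
      assume "frac x = frac y"
      then have "x - y = of_int (\<lfloor>x\<rfloor> - \<lfloor>y\<rfloor>)" by (simp add: frac_def)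
      then show "x - y \<in> \<int>" by (metis Ints_of_int)
    next
      assume "x - y \<in> \<int>"
      then show "frac x = frac y" using frac_add_int_right[of "x - y" y] by simp
    qed
    finally show ?thesis .
  qed
  have G_ne: "G x \<noteq> G y" if "x < y" "y < x + 1" for x y
  proof
    assume "G x = G y"
    then obtain k :: int where "x - y = of_int k" using G_eq Ints_cases by metis
    then have "-1 < k" "k < 0" using that by linarith+
    then show False by simp
  qed
  have strict: "a < b" "b < c" "c < d" "d < a + 1"
  proof -
    have "a \<noteq> b"
    proof
      assume "a = b"
      then have "G c = G d" "d - c = 1/2" using sum half by auto
      then show False using G_ne[of c d] by simp
    qed
    moreover have "c \<noteq> d"
    proof
      assume "c = d"
      then have "G a = G b" "b - a = 1/2" using sum half by auto
      then show False using G_ne[of a b] by simp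
    qed
    moreover have "b \<noteq> c"
    proof
      assume "b = c"
      then have "G a = G d" "d - a = 1/2" using sum half by (auto simp: algebra_simps)
      then show False using G_ne[of a d] by simp
    qed
    moreover have "d \<noteq> a + 1"
    proof
      assume "d = a + 1"
      then have "G b = G c" "c - b = 1/2"
        using sum half \<open>\<And>x. G (x + 1) = G x\<close>[of a] by (auto simp: algebra_simps)
      then show False using G_ne[of b c] by simp
    qed
    ultimately show "a < b" "b < c" "c < d" "d < a + 1" using le by auto
  qed
  have dist: "distinct [G a, G b, G c, G d]"
    using G_ne strict by auto
  have "parallelogram (G a) (G b) (G c) (G d)"
  proof (cases "collinear {G a, G b, G c}")
    case True
    then show ?thesis
      unfolding parallelogram_def using degenerate_parallelogramI[OF _ dist sum] by simp
  next
    case False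
    then show ?thesis
      unfolding parallelogram_def nondegenerate_parallelogram_def using sum by simp
  qed
  moreover have "frac a < 3/4 \<or> frac b < 3/4 \<or> frac c < 3/4 \<or> frac d < 3/4"
  proof (rule ccontr)
    assume "\<not> ?thesis"
    then have late: "frac a \<ge> 3/4" "frac b \<ge> 3/4" "frac c \<ge> 3/4" "frac d \<ge> 3/4" by auto
    define k where "k = \<lfloor>b\<rfloor> - \<lfloor>a\<rfloor> + (\<lfloor>d\<rfloor> - \<lfloor>c\<rfloor>)"
    have "of_int k = 1/2 - (frac b - frac a) - (frac d - frac c)"
      using half by (simp add: k_def frac_def)
    then have "0 < k" "k < 1"
      using late frac_lt_1[of a] frac_lt_1[of b] frac_lt_1[of c] frac_lt_1[of d] by linarith+
    then show False by simp
  qed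
  ultimately show ?thesis
    using that[of "frac a" "frac b" "frac c" "frac d"] frac01 by (auto simp: G_def)
qed

text \<open>Reparametrizing by a high power \<open>x \<mapsto> x ^ Suc n\<close> squeezes the image of \<open>[0, 3/4)\<close> into a short arc
  that starts at \<open>\<gamma> 0\<close>, and this interval contains a parameter of a vertex.\<close>

lemma simple_loop_inscribed_vertex_near_start:
  fixes \<gamma> :: "real \<Rightarrow> real ^ 3"
  assumes \<gamma>: "simple_loop \<gamma>" and \<epsilon>: "\<epsilon> > 0"
  shows "\<exists>p \<in> inscribed_parallelogram_vertices \<gamma>. dist p (\<gamma> 0) < \<epsilon>"
proof -
  have cont: "continuous_on {0..1} \<gamma>" "\<gamma> 0 = \<gamma> 1" and inj: "inj_on \<gamma> {0..<1}"
    using \<gamma> by (auto simp: simple_loop_iff)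
  obtain \<eta> where \<eta>: "\<eta> > 0" "\<And>x. \<lbrakk>x \<in> {0..1}; dist x 0 < \<eta>\<rbrakk> \<Longrightarrow> dist (\<gamma> x) (\<gamma> 0) < \<epsilon>"
    using cont(1) \<epsilon> unfolding continuous_on_iff by (metis atLeastAtMost_iff order_refl zero_le_one)
  obtain n where n: "(3/4) ^ n < \<eta>"
    using real_arch_pow_inv[OF \<eta>(1), of "3/4"] by auto
  define \<beta> where "\<beta> x = \<gamma> (x ^ Suc n)" for x
  have "simple_loop \<beta>"
    unfolding simple_loop_iff
  proof (intro conjI)
    show "continuous_on {0..1} \<beta>"
      unfolding \<beta>_def
      by (intro continuous_on_compose2[OF cont(1)] continuous_intros)
        (auto simp del: power_Suc simp: power_le_one)
    show "\<beta> 0 = \<beta> 1" using cont(2) by (simp add: \<beta>_def)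
    show "inj_on \<beta> {0..<1}"
    proof (rule inj_onI)
      fix x y :: real assume xy: "x \<in> {0..<1}" "y \<in> {0..<1}" "\<beta> x = \<beta> y"
      have "x ^ Suc n \<in> {0..<1}" "y ^ Suc n \<in> {0..<1}"
        using xy by (auto simp del: power_Suc simp: power_less_one_iff)
      then have "x ^ Suc n = y ^ Suc n"
        using xy(3) inj_onD[OF inj] by (simp add: \<beta>_def del: power_Suc)
      then show "x = y"
        using xy by (intro power_inject_base[of x n y]) auto
    qed
  qed
  then obtain w x y z where wxyz: "{w, x, y, z} \<subseteq> {0..<1}" "w < 3/4 \<or> x < 3/4 \<or> y < 3/4 \<or> z < 3/4"
      "parallelogram (\<beta> w) (\<beta> x) (\<beta> y) (\<beta> z)"
    using simple_loop_inscribed_quadruple by metis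
  have image: "\<beta> t \<in> path_image \<gamma>" if "t \<in> {0..<1}" for t
    unfolding \<beta>_def path_image_def using that by (intro imageI) (auto simp del: power_Suc simp: power_le_one)
  have near: "dist (\<beta> t) (\<gamma> 0) < \<epsilon>" if "t \<in> {0..<1}" "t < 3/4" for t
  proof -
    have "t ^ Suc n \<le> t ^ n"
      using that by (intro power_decreasing) auto
    also have "\<dots> \<le> (3/4) ^ n"
      using that by (intro power_mono) auto
    finally have "t ^ Suc n < \<eta>" using n by linarith
    then show ?thesis
      unfolding \<beta>_def using that by (intro \<eta>(2)) (auto simp del: power_Suc simp: power_le_one)
  qed
  have "{\<beta> w, \<beta> x, \<beta> y, \<beta> z} \<subseteq> inscribed_parallelogram_vertices \<gamma>"
    unfolding inscribed_parallelogram_vertices_def using wxyz(1,3) image by blast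
  then show ?thesis
    using wxyz(1,2) near by blast
qed

theorem theorem2p4:
  fixes \<gamma> :: "real \<Rightarrow> real ^ 3"
  assumes "simple_loop \<gamma>"
  shows "path_image \<gamma> \<subseteq> closure (inscribed_parallelogram_vertices \<gamma>)"
proof
  fix p assume "p \<in> path_image \<gamma>"
  then obtain t where t: "t \<in> {0..1}" "p = \<gamma> t" by (auto simp: path_image_def)
  have \<gamma>: "simple_path \<gamma>" "pathfinish \<gamma> = pathstart \<gamma>"
    using assms by (auto simp: simple_loop_def)
  let ?\<beta> = "shiftpath t \<gamma>"
  have "simple_loop ?\<beta>"
    unfolding simple_loop_def using simple_path_shiftpath[OF \<gamma>] closed_shiftpath[OF \<gamma>(2)] t(1) by simp
  moreover have "?\<beta> 0 = p"
    using t by (simp add: shiftpath_def)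
  moreover have "inscribed_parallelogram_vertices ?\<beta> = inscribed_parallelogram_vertices \<gamma>"
    unfolding inscribed_parallelogram_vertices_def path_image_shiftpath[OF t(1) \<gamma>(2)] ..
  ultimately show "p \<in> closure (inscribed_parallelogram_vertices \<gamma>)"
    using simple_loop_inscribed_vertex_near_start[of ?\<beta>] by (simp add: closure_approachable)
qed

end
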